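(* For all integers $r,n$ with $n\ge 0$, $$(-1)^{n(r-1)}\sum_{k=0}^n\frac{\binom{n}{k}}{\binom{2k}{k}}2^{2k}(-1)^{k+1}L_r^k F_{2rn-rk}=\sum_{k=0}^n\binom{n}{k}(-1)^{k(r-1)}\frac{L_r^k F_{rk}}{2k-1} =\frac{2^{2n}}{\binom{2n}{n}}\sum_{k=0}^n\binom{2k}{k}(-1)^{k(r-1)}\frac{2^{-2k} F_{2rk}}{2k-1}.$$
   Context: The Fibonacci numbers $F_m$ ($m\in\mathbb Z$) are defined by $F_0=0$, $F_1=1$ and $F_{m+2}=F_{m+1}+F_m$ for all $m\in\mathbb Z$. The Lucas numbers $L_m$ ($m\in\mathbb Z$) satisfy the same recursion with $L_0=2$, $L_1=1$. *)

theory Defs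
  imports Complex_Main "HOL-Number_Theory.Fib"
begin

text \<open>
  Fibonacci and Lucas numbers with integer indices. For negative indices the recursion
  \<open>F (m + 2) = F (m + 1) + F m\<close> is read backwards. The recursion over all integers
  and the uniqueness of its solution are proved below.
\<close>

function fibonacci :: "int \<Rightarrow> int" where
  "fibonacci m =
     (if m = 0 then 0
      else if m = 1 then 1
      else if m > 1 then fibonacci (m - 1) + fibonacci (m - 2)
      else fibonacci (m + 2) - fibonacci (m + 1))"
  by auto
termination
  by (relation "measure (\<lambda>m. if m \<ge> 0 then nat m else nat (- m) + 2)") auto

function lucas :: "int \<Rightarrow> int" where
  "lucas m =
     (if m = 0 then 2
      else if m = 1 then 1
      else if m > 1 then lucas (m - 1) + lucas (m - 2)
      else lucas (m + 2) - lucas (m + 1))"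
  by auto
termination
  by (relation "measure (\<lambda>m. if m \<ge> 0 then nat m else nat (- m) + 2)") auto

declare fibonacci.simps [simp del] lucas.simps [simp del]

lemma fibonacci_0 [simp]: "fibonacci 0 = 0"
  and fibonacci_1 [simp]: "fibonacci 1 = 1"
  by (simp_all add: fibonacci.simps)

lemma lucas_0 [simp]: "lucas 0 = 2"
  and lucas_1 [simp]: "lucas 1 = 1"
  by (simp_all add: lucas.simps)

lemma fibonacci_rec: "fibonacci (m + 2) = fibonacci (m + 1) + fibonacci m"
proof (cases "m \<ge> 0")
  case True
  then show ?thesis by (subst fibonacci.simps) (simp add: algebra_simps)
next
  case False
  then show ?thesis by (subst (3) fibonacci.simps) simp
qed

lemma lucas_rec: "lucas (m + 2) = lucas (m + 1) + lucas m"
proof (cases "m \<ge> 0")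
  case True
  then show ?thesis by (subst lucas.simps) (simp add: algebra_simps)
next
  case False
  then show ?thesis by (subst (3) lucas.simps) simp
qed

lemma int_recurrence_unique:
  fixes f g :: "int \<Rightarrow> int"
  assumes f: "\<And>m. f (m + 2) = f (m + 1) + f m"
    and g: "\<And>m. g (m + 2) = g (m + 1) + g m"
    and init: "f 0 = g 0" "f 1 = g 1"
  shows "f = g"
proof
  fix m
  have "f m = g m \<and> f (m + 1) = g (m + 1)"
  proof (induction m rule: int_induct[where k = 0])
    case base
    show ?case using init by simp
  next
    case (step1 i)
    then show ?case using f[of i] g[of i] by (simp add: algebra_simps)
  next
    case (step2 i)
    then show ?case using f[of "i - 1"] g[of "i - 1"] by (simp add: algebra_simps)
  qed
  then show "f m = g m" by simp
qed

lemma fibonacci_of_nat: "fibonacci (int n) = int (fib n)"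
proof (induction n rule: fib.induct)
  case (3 n)
  then show ?case using fibonacci_rec[of "int n"] by (simp add: algebra_simps)
qed simp_all

end

theory Submission
  imports Defs
begin

text \<open>
  Let \<open>\<alpha>\<close> be the golden ratio and \<open>\<beta>\<close> its conjugate. By Binet's formulas (\<open>fibonacci_Binet\<close>,
  \<open>lucas_Binet\<close>), \<open>F\<^sub>m = (\<alpha>\<^sup>m - \<beta>\<^sup>m) / \<surd>5\<close> and \<open>L\<^sub>m = \<alpha>\<^sup>m + \<beta>\<^sup>m\<close> for all integers \<open>m\<close>. Put \<open>a = \<alpha>\<^sup>r\<close>,
  \<open>b = \<beta>\<^sup>r\<close> and \<open>s = (-1)\<^bsup>r-1\<^esup>\<close>, so that \<open>a b = -s\<close> and \<open>L\<^sub>r = a + b\<close>. With \<open>L\<^sub>r\<close> held fixed, each of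
  the three expressions in the theorem is \<open>(P(a) - P(b)) / \<surd>5\<close> for some polynomial \<open>P\<close>. Write
  \<open>x = s L\<^sub>r a\<close>; because \<open>s a\<^sup>2 = 1 + x\<close>, the three values \<open>P(a)\<close> are respectively

  \<open>- \<Sum>\<^sub>k (n choose k) 4\<^sup>k / (2k choose k) (-x)\<^sup>k (1 + x)\<^bsup>n-k\<^esup>\<close>,
  \<open>\<Sum>\<^sub>k (n choose k) x\<^sup>k / (2k - 1)\<close> and
  \<open>4\<^sup>n / (2n choose n) \<Sum>\<^sub>k (2k choose k) ((1 + x) / 4)\<^sup>k / (2k - 1)\<close>.

  These are the same polynomial in \<open>x\<close>: each takes the value \<open>-1\<close> at \<open>n = 0\<close> and satisfies
  \<open>(2n + 1) f\<^bsub>n+1\<^esub> = (2n + 2) f\<^sub>n + (1 + x)\<^bsup>n+1\<^esup>\<close>. For the second this is a comparison of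
  coefficients; for the third the recurrence merely adds the last summand; for the first one
  writes \<open>1 = (1 + x) + (-x)\<close> and compares coefficients of a form of degree \<open>n + 1\<close> in
  \<open>1 + x\<close> and \<open>-x\<close>. The resulting equalities are \<open>inv_central_form_eq\<close> and \<open>central_sum_eq\<close>; they
  hold for every real \<open>x\<close>, hence also for \<open>x = s L\<^sub>r b\<close>, which gives \<open>P(b)\<close>.
\<close>

section \<open>Three forms of one polynomial\<close>

definition weighted_binomial_sum :: "nat \<Rightarrow> real \<Rightarrow> real" where
  "weighted_binomial_sum n x = (\<Sum>k=0..n. real (n choose k) * x ^ k / (2 * real k - 1))"

definition central_sum :: "nat \<Rightarrow> real \<Rightarrow> real" where
  "central_sum n y = 2 ^ (2 * n) / real ((2 * n) choose n) *
     (\<Sum>k=0..n. real ((2 * k) choose k) * (y / 4) ^ k / (2 * real k - 1))"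

text \<open>
  The arguments stand for \<open>1 + x\<close> and \<open>-x\<close>. They are kept independent so that the form is
  homogeneous and its recurrence can be read off monomial by monomial.
\<close>
definition inv_central_form :: "nat \<Rightarrow> real \<Rightarrow> real \<Rightarrow> real" where
  "inv_central_form n y z =
     (\<Sum>k=0..n. real (n choose k) * (2 ^ (2 * k) / real ((2 * k) choose k)) * z ^ k * y ^ (n - k))"

lemma central_binomial_Suc:
  "real (Suc k) * real ((2 * Suc k) choose Suc k) = 2 * (2 * real k + 1) * real ((2 * k) choose k)"
proof -
  have e: "2 * Suc k = Suc (Suc (2 * k))" by simp
  have "Suc k * ((2 * Suc k) choose Suc k) = Suc (Suc (2 * k)) * (Suc (2 * k) choose k)"
    unfolding e by (metis Suc_times_binomial_eq mult.commute)
  moreover have "Suc k * (Suc (2 * k) choose k) = Suc (2 * k) * ((2 * k) choose k)"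
    using binomial_absorb_comp[of "Suc (2 * k)" k] by simp
  ultimately have "Suc k * (Suc k * ((2 * Suc k) choose Suc k))
      = Suc k * (2 * (Suc (2 * k) * ((2 * k) choose k)))"
    by (metis e mult.left_commute mult_2 mult_Suc_right add_mult_distrib)
  then have "Suc k * ((2 * Suc k) choose Suc k) = 2 * (Suc (2 * k) * ((2 * k) choose k))"
    by (simp only: mult_cancel1) simp
  then have "real (Suc k * ((2 * Suc k) choose Suc k))
      = real (2 * (Suc (2 * k) * ((2 * k) choose k)))"
    by (simp only:)
  then show ?thesis by (simp only: of_nat_mult of_nat_Suc) (simp add: algebra_simps)
qed

text \<open>The ratio of successive central binomial coefficients, for the weights \<open>4\<^sup>k / (2k choose k)\<close>
  that occur in both \<open>central_sum\<close> and \<open>inv_central_form\<close>.\<close>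
lemma inv_central_Suc:
  fixes k :: nat
  defines "c \<equiv> \<lambda>j. 2 ^ (2 * j) / real ((2 * j) choose j)"
  shows "(2 * real k + 1) * c (Suc k) = 2 * real (Suc k) * c k"
proof -
  have p: "real ((2 * k) choose k) > 0" "real ((2 * Suc k) choose Suc k) > 0"
    by (simp_all only: of_nat_0_less_iff zero_less_binomial_iff) auto
  have "(2 * u + 1) * (4 * w / q) = 2 * v * (w / m)"
    if "m > 0" "q > 0" "v * q = 2 * (2 * u + 1) * m" for u v w m q :: real
  proof -
    have "(2 * u + 1) * (4 * w / q) = 2 * (2 * (2 * u + 1) * m) * w / (m * q)"
      using that(1,2) by (simp add: field_simps)
    also have "\<dots> = 2 * v * (w / m)"
      unfolding that(3)[symmetric] using that(1,2) by simp
    finally show ?thesis .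
  qed
  from this[OF p central_binomial_Suc] show ?thesis
    unfolding c_def by (simp add: power_mult del: binomial_Suc_Suc)
qed

lemma binomial_absorb_comp_real:
  assumes "k \<le> Suc n"
  shows "real (Suc n) * real (n choose k) = (real (Suc n) - real k) * real (Suc n choose k)"
proof -
  have "real ((Suc n - k) * (Suc n choose k)) = real (Suc n * (n choose k))"
    using binomial_absorb_comp[of "Suc n" k] by simp
  then show ?thesis
    using assms by (simp only: of_nat_mult of_nat_diff)
qed

lemma binomial_absorb_real:
  "real (Suc n) * real (n choose k) = real (Suc k) * real (Suc n choose Suc k)"
  using Suc_times_binomial_eq[of n k] by (metis mult.commute of_nat_mult)

text \<open>
  By absorption, \<open>(2n + 1) (n+1 choose k) - (2n + 2) (n choose k) = (2k - 1) (n+1 choose k)\<close>. The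
  factor \<open>2k - 1\<close> cancels the denominators, and what remains is the binomial expansion of
  \<open>(1 + x)\<^bsup>n+1\<^esup>\<close>.
\<close>
lemma weighted_binomial_sum_Suc:
  "(2 * real n + 1) * weighted_binomial_sum (Suc n) x
     = (2 * real n + 2) * weighted_binomial_sum n x + (1 + x) ^ Suc n"
proof -
  have odd: "2 * real k - 1 \<noteq> 0" for k :: nat
  proof
    assume "2 * real k - 1 = 0"
    then have "real (2 * k) = real 1" by simp
    then have "2 * k = 1" by (simp only: of_nat_eq_iff)
    then show False by presburger
  qed
  have ext: "weighted_binomial_sum n x
      = (\<Sum>k=0..Suc n. real (n choose k) * x ^ k / (2 * real k - 1))"
    by (simp add: weighted_binomial_sum_def)
  have bin: "(1 + x) ^ Suc n = (\<Sum>k=0..Suc n. real (Suc n choose k) * x ^ k)"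
    using binomial_ring[of x 1 "Suc n"] by (simp add: add.commute atLeast0AtMost)
  have coeff: "(2 * real n + 1) * (real (Suc n choose k) * x ^ k / (2 * real k - 1))
      = (2 * real n + 2) * (real (n choose k) * x ^ k / (2 * real k - 1))
        + real (Suc n choose k) * x ^ k" if "k \<le> Suc n" for k
  proof -
    have "(2 * real n + 1) * real (Suc n choose k)
        = (2 * real n + 2) * real (n choose k) + (2 * real k - 1) * real (Suc n choose k)"
      using binomial_absorb_comp_real[OF that] by (simp add: algebra_simps del: binomial_Suc_Suc)
    then have "(2 * real n + 1) * (real (Suc n choose k) * x ^ k / (2 * real k - 1))
        = ((2 * real n + 2) * real (n choose k) + (2 * real k - 1) * real (Suc n choose k))
          * x ^ k / (2 * real k - 1)"
      by (metis mult.assoc times_divide_eq_right)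
    also have "\<dots> = (2 * real n + 2) * (real (n choose k) * x ^ k / (2 * real k - 1))
        + real (Suc n choose k) * x ^ k"
      using odd[of k]
      by (simp only: distrib_right add_divide_distrib mult.assoc nonzero_mult_div_cancel_left
          times_divide_eq_right not_False_eq_True)
    finally show ?thesis .
  qed
  show ?thesis
    unfolding ext bin unfolding weighted_binomial_sum_def sum_distrib_left sum.distrib[symmetric]
    by (rule sum.cong[OF refl]) (rule coeff, simp)
qed

text \<open>
  The prefactors of consecutive sums have quotient \<open>(2n + 2) / (2n + 1)\<close>, and \<open>2n + 1\<close> is also the
  denominator of the summand \<open>k = n + 1\<close>, whose central binomial coefficient and power of \<open>4\<close>
  cancel against the prefactor.
\<close>
lemma central_sum_Suc:
  "(2 * real n + 1) * central_sum (Suc n) y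
     = (2 * real n + 2) * central_sum n y + y ^ Suc n"
proof -
  define c where "c = (\<lambda>j. 2 ^ (2 * j) / real ((2 * j) choose j))"
  define S where "S = (\<Sum>k=0..n. real ((2 * k) choose k) * (y / 4) ^ k / (2 * real k - 1))"
  define B where "B = real ((2 * Suc n) choose Suc n)"
  have B: "B > 0" unfolding B_def
    by (simp only: of_nat_0_less_iff zero_less_binomial_iff) auto
  have n: "central_sum n y = c n * S" by (simp add: central_sum_def c_def S_def)
  have "central_sum (Suc n) y
      = c (Suc n) * (S + B * (y / 4) ^ Suc n / (2 * real (Suc n) - 1))"
    unfolding central_sum_def c_def S_def B_def by (subst sum.atLeast0_atMost_Suc) (rule refl)
  also have "\<dots> = c (Suc n) * S + c (Suc n) * B * (y / 4) ^ Suc n / (2 * real n + 1)"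
    by (simp only: distrib_left times_divide_eq_right mult.assoc) simp
  also have "c (Suc n) * B = 4 ^ Suc n"
    using B by (simp add: c_def B_def power_mult del: binomial_Suc_Suc mult_Suc_right)
  also have "(4::real) ^ Suc n * (y / 4) ^ Suc n = y ^ Suc n"
    by (subst power_mult_distrib[symmetric]) simp
  finally have Suc: "central_sum (Suc n) y = c (Suc n) * S + y ^ Suc n / (2 * real n + 1)" .
  have "2 * real n + 1 > 0" by simp
  then have "(2 * real n + 1) * central_sum (Suc n) y
      = ((2 * real n + 1) * c (Suc n)) * S + y ^ Suc n"
    unfolding Suc
    by (simp only: distrib_left times_divide_eq_right mult.assoc
        nonzero_mult_div_cancel_left)
  also have "(2 * real n + 1) * c (Suc n) = (2 * real n + 2) * c n"
    using inv_central_Suc[of n] by (simp add: c_def del: binomial_Suc_Suc mult_Suc_right)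
  finally show ?thesis by (simp add: n del: power_Suc)
qed

text \<open>
  Multiplying the form of degree \<open>n\<close> by \<open>y + z\<close> gives each monomial two contributions, and the
  absorption identities turn their weights into \<open>2 (n + 1 - k)\<close> and \<open>2 k - 1\<close>. These add up to
  \<open>2 n + 1\<close> independently of \<open>k\<close>. The monomial \<open>y\<^bsup>n+1\<^esup>\<close> receives nothing from the multiplication by
  \<open>z\<close>, whereas \<open>2 k - 1\<close> would be \<open>-1\<close> there; this discrepancy is the extra term.
\<close>
lemma inv_central_form_Suc:
  "(2 * real n + 1) * inv_central_form (Suc n) y z
     = (2 * real n + 2) * (y + z) * inv_central_form n y z - y ^ Suc n"
proof -
  define c where "c = (\<lambda>j. 2 ^ (2 * j) / real ((2 * j) choose j))"
  define t where "t = (\<lambda>k. real (Suc n choose k) * c k * z ^ k * y ^ (Suc n - k))"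
  have "(2 * real n + 2) * y * inv_central_form n y z
      = (\<Sum>k=0..n. (2 * real n + 2) * real (n choose k) * c k * z ^ k * y ^ (Suc n - k))"
    unfolding inv_central_form_def sum_distrib_left c_def
    by (rule sum.cong[OF refl]) (simp add: Suc_diff_le)
  also have "\<dots> = (\<Sum>k=0..n. 2 * (real (Suc n) - real k) * t k)"
  proof (rule sum.cong[OF refl])
    fix k assume "k \<in> {0..n}"
    then have "(2 * real n + 2) * real (n choose k)
        = 2 * (real (Suc n) - real k) * real (Suc n choose k)"
      using binomial_absorb_comp_real[of k n] by (simp add: algebra_simps del: binomial_Suc_Suc)
    then show "(2 * real n + 2) * real (n choose k) * c k * z ^ k * y ^ (Suc n - k)
        = 2 * (real (Suc n) - real k) * t k"
      by (simp add: t_def del: binomial_Suc_Suc)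
  qed
  also have "\<dots> = (\<Sum>k=0..Suc n. 2 * (real (Suc n) - real k) * t k)" by simp
  finally have fst: "(2 * real n + 2) * y * inv_central_form n y z
      = (\<Sum>k=0..Suc n. 2 * (real (Suc n) - real k) * t k)" .
  have "(2 * real n + 2) * z * inv_central_form n y z
      = (\<Sum>k=0..n. (2 * real n + 2) * real (n choose k) * c k * z ^ Suc k * y ^ (n - k))"
    unfolding inv_central_form_def sum_distrib_left c_def
    by (rule sum.cong[OF refl]) simp
  also have "\<dots> = (\<Sum>k=0..n. (2 * real (Suc k) - 1) * t (Suc k))"
  proof (rule sum.cong[OF refl])
    fix k
    have "(2 * real n + 2) * real (n choose k) * c k = real (Suc n choose Suc k) * (2 * real (Suc k) * c k)"
    proof -
      have "(2 * real n + 2) * real (n choose k) * c k = 2 * (real (Suc n) * real (n choose k)) * c k"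
        by (simp add: algebra_simps)
      then show ?thesis
        unfolding binomial_absorb_real by (simp only: mult_ac)
    qed
    also have "\<dots> = (2 * real (Suc k) - 1) * (real (Suc n choose Suc k) * c (Suc k))"
    proof -
      have "2 * real (Suc k) - 1 = 2 * real k + 1" by simp
      then have "2 * real (Suc k) * c k = (2 * real (Suc k) - 1) * c (Suc k)"
        using inv_central_Suc[of k] unfolding c_def by (simp only:)
      then show ?thesis
        by (simp only: mult_ac)
    qed
    finally show "(2 * real n + 2) * real (n choose k) * c k * z ^ Suc k * y ^ (n - k)
        = (2 * real (Suc k) - 1) * t (Suc k)"
      by (simp add: t_def del: binomial_Suc_Suc power_Suc)
  qed
  \<comment> \<open>The missing summand at \<open>k = 0\<close> is \<open>-y\<^bsup>n+1\<^esup>\<close>.\<close>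
  also have "\<dots> = (\<Sum>k=0..Suc n. (2 * real k - 1) * t k) + y ^ Suc n"
    by (subst sum.atLeast0_atMost_Suc_shift) (simp add: t_def c_def del: binomial_Suc_Suc)
  finally have snd: "(2 * real n + 2) * z * inv_central_form n y z
      = (\<Sum>k=0..Suc n. (2 * real k - 1) * t k) + y ^ Suc n" .
  have "(2 * real n + 1) * inv_central_form (Suc n) y z = (\<Sum>k=0..Suc n. (2 * real n + 1) * t k)"
    by (simp only: inv_central_form_def t_def c_def sum_distrib_left)
  also have "\<dots> = (\<Sum>k=0..Suc n. 2 * (real (Suc n) - real k) * t k + (2 * real k - 1) * t k)"
    by (rule sum.cong[OF refl]) (simp add: algebra_simps)
  also have "\<dots> = (2 * real n + 2) * (y + z) * inv_central_form n y z - y ^ Suc n"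
    using fst snd by (simp only: sum.distrib) (simp add: ring_distribs)
  finally show ?thesis .
qed

lemma central_sum_eq: "central_sum n (1 + x) = weighted_binomial_sum n x"
proof (induction n)
  case 0
  show ?case by (simp add: central_sum_def weighted_binomial_sum_def)
next
  case (Suc n)
  have "(2 * real n + 1) * central_sum (Suc n) (1 + x)
      = (2 * real n + 1) * weighted_binomial_sum (Suc n) x"
    by (simp only: central_sum_Suc weighted_binomial_sum_Suc Suc.IH)
  moreover have "2 * real n + 1 \<noteq> 0" by linarith
  ultimately show ?case by (simp only: mult_cancel_left simp_thms)
qed

lemma inv_central_form_eq: "- inv_central_form n (1 + x) (- x) = weighted_binomial_sum n x"
proof (induction n)
  case 0
  show ?case by (simp add: inv_central_form_def weighted_binomial_sum_def)
next
  case (Suc n)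
  have "(2 * real n + 1) * (- inv_central_form (Suc n) (1 + x) (- x))
      = (2 * real n + 1) * weighted_binomial_sum (Suc n) x"
    using inv_central_form_Suc[of n "1 + x" "- x"] weighted_binomial_sum_Suc[of n x]
    unfolding Suc.IH[symmetric] by simp
  moreover have "2 * real n + 1 \<noteq> 0" by linarith
  ultimately show ?case by (simp only: mult_cancel_left simp_thms)
qed

section \<open>Binet formulas for integer indices\<close>

definition golden :: real where "golden = (1 + sqrt 5) / 2"

definition golden_conj :: real where "golden_conj = (1 - sqrt 5) / 2"

lemma golden_square: "golden\<^sup>2 = golden + 1"
  and golden_conj_square: "golden_conj\<^sup>2 = golden_conj + 1"
  and golden_mult_conj: "golden * golden_conj = - 1"
  by (simp_all add: golden_def golden_conj_def field_simps power2_eq_square)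

lemma golden_nonzero: "golden \<noteq> 0" and golden_conj_nonzero: "golden_conj \<noteq> 0"
  using golden_mult_conj by auto

text \<open>Two consecutive values determine a solution in both directions. Real values are needed
  because the right-hand sides of Binet's formulas are built from irrational sequences.\<close>
lemma real_recurrence_unique:
  fixes f g :: "int \<Rightarrow> real"
  assumes f: "\<And>m. f (m + 2) = f (m + 1) + f m"
    and g: "\<And>m. g (m + 2) = g (m + 1) + g m"
    and init: "f 0 = g 0" "f 1 = g 1"
  shows "f m = g m"
proof -
  have "f m = g m \<and> f (m + 1) = g (m + 1)"
  proof (induction m rule: int_induct[where k = 0])
    case base
    show ?case using init by simp
  next
    case (step1 i)
    then show ?case using f[of i] g[of i] by (simp add: algebra_simps)
  next
    case (step2 i)
    then show ?case using f[of "i - 1"] g[of "i - 1"] by (simp add: algebra_simps)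
  qed
  then show ?thesis by simp
qed

lemma powi_recurrence:
  fixes c :: real
  assumes "c\<^sup>2 = c + 1" "c \<noteq> 0"
  shows "c powi (m + 2) = c powi (m + 1) + c powi m"
proof -
  have "c powi (m + 2) = c powi m * c\<^sup>2"
    using assms(2) by (simp add: power_int_add)
  also have "\<dots> = c powi (m + 1) + c powi m"
    using assms by (simp add: power_int_add ring_distribs)
  finally show ?thesis .
qed

lemmas golden_powi_recurrence = powi_recurrence[OF golden_square golden_nonzero]
lemmas golden_conj_powi_recurrence = powi_recurrence[OF golden_conj_square golden_conj_nonzero]

lemma fibonacci_Binet:
  "real_of_int (fibonacci m) = (golden powi m - golden_conj powi m) / sqrt 5"
proof (rule real_recurrence_unique)
  show "real_of_int (fibonacci 1) = (golden powi 1 - golden_conj powi 1) / sqrt 5"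
    by (simp add: golden_def golden_conj_def field_simps)
qed (simp_all add: fibonacci_rec golden_powi_recurrence golden_conj_powi_recurrence
      diff_divide_distrib add_divide_distrib)

lemma lucas_Binet: "real_of_int (lucas m) = golden powi m + golden_conj powi m"
proof (rule real_recurrence_unique)
  show "real_of_int (lucas 1) = golden powi 1 + golden_conj powi 1"
    by (simp add: golden_def golden_conj_def field_simps)
qed (simp_all add: lucas_rec golden_powi_recurrence golden_conj_powi_recurrence)

section \<open>Sums over Fibonacci and Lucas numbers\<close>

theorem proposition6p1:
  fixes r :: int and n :: nat
  shows
    "(-1 :: real) powi (int n * (r - 1)) *
       (\<Sum>k=0..n. real (n choose k) / real ((2 * k) choose k) * 2 ^ (2 * k) * (-1) ^ (k + 1) *
          real_of_int (lucas r) ^ k * real_of_int (fibonacci (2 * r * int n - r * int k)))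
     = (\<Sum>k=0..n. real (n choose k) * (-1) powi (int k * (r - 1)) *
          (real_of_int (lucas r) ^ k * real_of_int (fibonacci (r * int k)) / (2 * real k - 1)))
   \<and>
     (\<Sum>k=0..n. real (n choose k) * (-1) powi (int k * (r - 1)) *
          (real_of_int (lucas r) ^ k * real_of_int (fibonacci (r * int k)) / (2 * real k - 1)))
     = 2 ^ (2 * n) / real ((2 * n) choose n) *
       (\<Sum>k=0..n. real ((2 * k) choose k) * (-1) powi (int k * (r - 1)) *
          (2 powi (- 2 * int k) * real_of_int (fibonacci (2 * r * int k)) / (2 * real k - 1)))"
proof -
  define a where "a = golden powi r"
  define b where "b = golden_conj powi r"
  define s :: real where "s = (-1) powi (r - 1)"
  define L where "L = a + b"
  have lucas: "real_of_int (lucas r) = L"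
    by (simp add: lucas_Binet L_def a_def b_def)
  have fib: "real_of_int (fibonacci (r * int j)) = (a ^ j - b ^ j) / sqrt 5" for j
    by (simp add: fibonacci_Binet a_def b_def power_int_mult)
  have sign: "(-1) powi (int k * (r - 1)) = s ^ k" for k
    unfolding s_def by (subst mult.commute) (simp add: power_int_mult)
  \<comment> \<open>Two facts make \<open>s c\<^sup>2 = 1 + s L c\<close> for \<open>c = a\<close> and \<open>c = b\<close>: \<open>a b = -s\<close> and \<open>s\<^sup>2 = 1\<close>.\<close>
  have ab: "a * b = - s"
  proof -
    have "a * b = (-1) powi r"
      by (simp add: a_def b_def power_int_mult_distrib[symmetric] golden_mult_conj)
    also have "\<dots> = - s"
      by (simp add: s_def power_int_diff)
    finally show ?thesis .
  qed
  have ss: "s * s = 1"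
    by (simp add: s_def power_int_mult_distrib[symmetric])
  have sq: "s * a\<^sup>2 = 1 + s * L * a" "s * b\<^sup>2 = 1 + s * L * b"
  proof -
    have "s * L * a = s * a\<^sup>2 + s * (a * b)" "s * L * b = s * b\<^sup>2 + s * (a * b)"
      by (simp_all add: L_def power2_eq_square algebra_simps)
    then show "s * a\<^sup>2 = 1 + s * L * a" "s * b\<^sup>2 = 1 + s * L * b"
      using ab ss by simp_all
  qed

  have A: "s ^ n * (\<Sum>k=0..n. real (n choose k) / real ((2 * k) choose k) * 2 ^ (2 * k)
        * (-1) ^ (k + 1) * L ^ k * real_of_int (fibonacci (2 * r * int n - r * int k)))
      = (- inv_central_form n (s * a\<^sup>2) (- (s * L * a))
         - (- inv_central_form n (s * b\<^sup>2) (- (s * L * b)))) / sqrt 5"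
  proof -
    \<comment> \<open>With \<open>s c\<^sup>2\<close> in place of \<open>1 + x\<close>, the factors \<open>s\<close> collect to the common sign \<open>s\<^sup>n\<close>
      and the powers of \<open>c\<close> to the index \<open>2n - k\<close> of the Fibonacci number.\<close>
    have mono: "(- (s * L * c)) ^ k * (s * c\<^sup>2) ^ (n - k) = s ^ n * (-1) ^ k * L ^ k * c ^ (2 * n - k)"
      if "k \<le> n" for c k
    proof -
      have "k + 2 * (n - k) = 2 * n - k"
        using that by simp
      then have "s ^ k * s ^ (n - k) = s ^ n" "c ^ k * c ^ (2 * (n - k)) = c ^ (2 * n - k)"
        using that by (simp_all only: power_add[symmetric] le_add_diff_inverse)
      moreover have "(- (s * L * c)) ^ k * (s * c\<^sup>2) ^ (n - k)
          = (s ^ k * s ^ (n - k)) * (-1) ^ k * L ^ k * (c ^ k * c ^ (2 * (n - k)))"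
        by (subst power_minus) (simp add: power_mult_distrib power_mult)
      ultimately show ?thesis by simp
    qed
    have summand: "s ^ n * (real (n choose k) / real ((2 * k) choose k) * 2 ^ (2 * k)
          * (-1) ^ (k + 1) * L ^ k * real_of_int (fibonacci (2 * r * int n - r * int k)))
        = (- (real (n choose k) * (2 ^ (2 * k) / real ((2 * k) choose k))
               * (- (s * L * a)) ^ k * (s * a\<^sup>2) ^ (n - k))
           - (- (real (n choose k) * (2 ^ (2 * k) / real ((2 * k) choose k))
               * (- (s * L * b)) ^ k * (s * b\<^sup>2) ^ (n - k)))) / sqrt 5" if "k \<le> n" for k
    proof -
      have "2 * r * int n - r * int k = r * int (2 * n - k)"
        using that by (simp add: of_nat_diff algebra_simps)
      then have F: "real_of_int (fibonacci (2 * r * int n - r * int k))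
          = (a ^ (2 * n - k) - b ^ (2 * n - k)) / sqrt 5"
        by (simp only: fib)
      show ?thesis
        unfolding F mult.assoc[of _ "_ ^ k" "_ ^ (n - k)"] mono[OF that]
        by (simp add: diff_divide_distrib right_diff_distrib mult_ac)
    qed
    show ?thesis
      unfolding inv_central_form_def sum_negf[symmetric] sum_subtractf[symmetric]
        sum_divide_distrib sum_distrib_left
      by (rule sum.cong[OF refl], rule summand) simp
  qed

  have B: "(\<Sum>k=0..n. real (n choose k) * s ^ k
        * (L ^ k * real_of_int (fibonacci (r * int k)) / (2 * real k - 1)))
      = (weighted_binomial_sum n (s * L * a) - weighted_binomial_sum n (s * L * b)) / sqrt 5"
    unfolding weighted_binomial_sum_def sum_subtractf[symmetric] sum_divide_distrib fib
    by (rule sum.cong[OF refl])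
      (simp add: power_mult_distrib diff_divide_distrib right_diff_distrib mult_ac)

  have C: "2 ^ (2 * n) / real ((2 * n) choose n) * (\<Sum>k=0..n. real ((2 * k) choose k) * s ^ k
        * (2 powi (- 2 * int k) * real_of_int (fibonacci (2 * r * int k)) / (2 * real k - 1)))
      = (central_sum n (s * a\<^sup>2) - central_sum n (s * b\<^sup>2)) / sqrt 5"
  proof -
    have summand: "real ((2 * k) choose k) * s ^ k
          * (2 powi (- 2 * int k) * real_of_int (fibonacci (2 * r * int k)) / (2 * real k - 1))
        = (real ((2 * k) choose k) * (s * a\<^sup>2 / 4) ^ k / (2 * real k - 1)
           - real ((2 * k) choose k) * (s * b\<^sup>2 / 4) ^ k / (2 * real k - 1)) / sqrt 5" for k
    proof -
      have "2 * r * int k = r * int (2 * k)" by simp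
      then have F: "real_of_int (fibonacci (2 * r * int k)) = (a ^ (2 * k) - b ^ (2 * k)) / sqrt 5"
        by (simp only: fib)
      have "(2::real) powi (- 2 * int k) = (2 powi (- 2)) powi int k"
        by (rule power_int_mult)
      also have "\<dots> = 1 / 4 ^ k"
        by (simp add: power_int_minus power_one_over inverse_eq_divide)
      finally have P: "(2::real) powi (- 2 * int k) = 1 / 4 ^ k" .
      show ?thesis
        unfolding F P
        by (simp add: power_mult_distrib power_divide power_mult[symmetric] diff_divide_distrib
            right_diff_distrib mult_ac)
    qed
    show ?thesis
      unfolding central_sum_def summand
      by (simp only: sum_divide_distrib[symmetric] sum_subtractf right_diff_distrib
          times_divide_eq_right)
  qed

  show ?thesis
    unfolding lucas sign A B C
    unfolding sq inv_central_form_eq central_sum_eq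
    by simp
qed

end
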